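(* Let $Y$ be a random variable whose moment generating function $E[e^{tY}]$ exists for $|t|<\delta$ for some $\delta>0$. Let $r$ be a positive integer and for $k\ge0$ define ${n+r\brace k+r}_{r,Y}$ ($n\ge k$) by $$\frac{1}{k!}\big(E[e^{tY}]-1\big)^k e^{rt}=\sum_{n=k}^{\infty}{n+r\brace k+r}_{r,Y}\frac{t^n}{n!},$$ and define $\phi^Y_{n,r}(x)=\sum_{k=0}^{n}{n+r\brace k+r}_{r,Y}x^k$. Then for all $n\ge0$, $$\phi^Y_{n+1,r}(x)=x\sum_{k=0}^{n}\binom{n}{k}E[Y^{k+1}]\phi^Y_{n-k,r}(x)+r\phi^Y_{n,r}(x).$$
   Context: $E$ denotes mathematical expectation. *)

theory Defs
  imports "HOL-Probability.Probability"
begin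

definition mgf :: "'a measure \<Rightarrow> ('a \<Rightarrow> real) \<Rightarrow> real \<Rightarrow> real" where
  "mgf M Y t = prob_space.expectation M (\<lambda>\<omega>. exp (t * Y \<omega>))"

(* The probabilistic r-Stirling number of the second kind {n + r, k + r}_{r,Y}: both arguments
   n and k are the unshifted ones.  The expansion required is
     (E[e^(tY)] - 1)^k / k! * e^(rt) = sum_{n >= k} {n + r, k + r}_{r,Y} t^n / n!
   in some neighbourhood of t = 0, the terms below n = k being absent. *)
definition prob_r_stirling ::
    "'a measure \<Rightarrow> ('a \<Rightarrow> real) \<Rightarrow> nat \<Rightarrow> nat \<Rightarrow> nat \<Rightarrow> real" where
  "prob_r_stirling M Y r n k =
     fact n * fps_nth (THE F.
       (\<lambda>t. 1 / fact k * (mgf M Y t - 1) ^ k * exp (real r * t)) has_fps_expansion F \<and>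
       (\<forall>i<k. fps_nth F i = 0)) n"

definition prob_r_bell_poly ::
    "'a measure \<Rightarrow> ('a \<Rightarrow> real) \<Rightarrow> nat \<Rightarrow> nat \<Rightarrow> real \<Rightarrow> real" where
  "prob_r_bell_poly M Y r n x = (\<Sum>k=0..n. prob_r_stirling M Y r n k * x ^ k)"

end

theory Submission
  imports Defs
begin

text \<open>
  Dominated convergence identifies the Taylor coefficients of the moment generating function
  \<open>m\<close> at \<open>0\<close> as \<open>E[Y\<^sup>n] / n!\<close>. For the formal series \<open>m\<close> and
  \<open>S\<^sub>k = (m - 1)\<^sup>k e\<^sup>r\<^sup>t / k!\<close>, differentiation gives
  \<open>S\<^sub>k' = m' S\<^sub>k\<^sub>-\<^sub>1 + r S\<^sub>k\<close>; comparing coefficients and summing against \<open>x\<^sup>k\<close> yields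
  the recurrence.
\<close>

section \<open>Uniqueness and powers of formal expansions\<close>

unbundle no vec_syntax
unbundle fps_syntax

text \<open>All derivatives of the zero function vanish, and the constant coefficient of the
  \<open>n\<close>-th formal derivative is \<open>fact n * F $ n\<close>; evaluating at 0 therefore
  kills every coefficient.\<close>

lemma has_fps_expansion_zero_imp_zero:
  fixes F :: "'a :: {banach, real_normed_field} fps"
  assumes "(\<lambda>_. 0) has_fps_expansion F"
  shows "F = 0"
proof (rule fps_ext)
  fix n
  have "(\<lambda>_. 0) has_fps_expansion (fps_deriv ^^ n) F"
  proof (induction n)
    case (Suc n)
    then show ?case
      using has_fps_expansion_deriv[OF Suc] by simp
  qed (use assms in simp)
  then have "(fps_deriv ^^ n) F $ 0 = 0"
    by (auto simp: has_fps_expansion_def eval_fps_at_0 dest: eventually_nhds_x_imp_x)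
  then show "F $ n = 0 $ n"
    by (simp add: fps_0th_higher_deriv)
qed

text \<open>This makes the definite description in \<open>prob_r_stirling\<close>
  meaningful.\<close>

lemma has_fps_expansion_unique:
  fixes f :: "'a :: {banach, real_normed_field} \<Rightarrow> 'a"
  assumes "f has_fps_expansion F" "f has_fps_expansion G"
  shows "F = G"
  using has_fps_expansion_zero_imp_zero[of "F - G"] has_fps_expansion_diff[OF assms] by simp

lemma has_fps_expansion_power:
  fixes f :: "'a :: {banach, real_normed_field} \<Rightarrow> 'a"
  assumes "f has_fps_expansion F"
  shows "(\<lambda>x. f x ^ n) has_fps_expansion F ^ n"
  by (induction n) (auto intro: fps_expansion_intros assms)

section \<open>Taylor expansion of the moment generating function\<close>

lemma exp_abs_le_add: "exp \<bar>x\<bar> \<le> exp x + exp (- x)" for x :: real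
  by (cases "x \<ge> 0") (auto simp: add_increasing add_increasing2)

text \<open>Existence of the generating function on both sides of 0 yields one integrable majorant
  for the whole exponential series in \<open>t * Y\<close>.\<close>

lemma integrable_exp_abs:
  fixes Y :: "'a \<Rightarrow> real"
  assumes [measurable]: "Y \<in> borel_measurable M"
    and "integrable M (\<lambda>\<omega>. exp (t * Y \<omega>))" "integrable M (\<lambda>\<omega>. exp (- t * Y \<omega>))"
  shows "integrable M (\<lambda>\<omega>. exp \<bar>t * Y \<omega>\<bar>)"
proof (rule Bochner_Integration.integrable_bound)
  show "integrable M (\<lambda>\<omega>. exp (t * Y \<omega>) + exp (- t * Y \<omega>))"
    using assms by auto
  show "AE \<omega> in M. norm (exp \<bar>t * Y \<omega>\<bar>) \<le> norm (exp (t * Y \<omega>) + exp (- t * Y \<omega>))"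
    using exp_abs_le_add[of "t * Y \<omega>" for \<omega>] by (simp add: add_nonneg_nonneg)
qed simp

text \<open>An arbitrary finite index set covers both uses: a single term of the series and a
  partial sum.\<close>

lemma sum_power_div_fact_le_exp:
  fixes x :: real
  assumes "x \<ge> 0" "finite A"
  shows "(\<Sum>i\<in>A. x ^ i / fact i) \<le> exp x"
proof -
  have "(\<lambda>i. x ^ i / fact i) sums exp x"
    using exp_converges[of x] by (simp add: field_simps)
  then show ?thesis
    using assms sum_le_suminf[of "\<lambda>i. x ^ i / fact i" A] by (simp add: sums_iff)
qed

lemma integrable_power_mgf:
  fixes Y :: "'a \<Rightarrow> real"
  assumes [measurable]: "Y \<in> borel_measurable M"
    and "integrable M (\<lambda>\<omega>. exp \<bar>t * Y \<omega>\<bar>)"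
  shows "integrable M (\<lambda>\<omega>. (t * Y \<omega>) ^ n / fact n)"
proof (rule Bochner_Integration.integrable_bound[OF assms(2)])
  show "AE \<omega> in M. norm ((t * Y \<omega>) ^ n / fact n) \<le> norm (exp \<bar>t * Y \<omega>\<bar>)"
    using sum_power_div_fact_le_exp[of "\<bar>t * Y \<omega>\<bar>" "{n}" for \<omega>]
    by (simp add: power_abs)
qed simp

lemma mgf_sums_moments:
  fixes Y :: "'a \<Rightarrow> real"
  assumes [measurable]: "Y \<in> borel_measurable M"
    and exp: "integrable M (\<lambda>\<omega>. exp \<bar>t * Y \<omega>\<bar>)"
  shows "(\<lambda>n. integral\<^sup>L M (\<lambda>\<omega>. Y \<omega> ^ n) / fact n * t ^ n) sums mgf M Y t"
proof -
  have int: "integrable M (\<lambda>\<omega>. (t * Y \<omega>) ^ n / fact n)" for n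
    by (rule integrable_power_mgf) (use assms in auto)
  have norm: "norm ((t * Y \<omega>) ^ n / fact n) = \<bar>t * Y \<omega>\<bar> ^ n / fact n" for n \<omega>
    by (simp add: power_abs)
  have "(\<lambda>n. integral\<^sup>L M (\<lambda>\<omega>. (t * Y \<omega>) ^ n / fact n)) sums
      integral\<^sup>L M (\<lambda>\<omega>. \<Sum>n. (t * Y \<omega>) ^ n / fact n)"
  proof (rule sums_integral[OF int])
    have "summable (\<lambda>n. x ^ n / fact n)" for x :: real
      using summable_exp[of x] by (simp add: field_simps)
    then show "AE \<omega> in M. summable (\<lambda>n. norm ((t * Y \<omega>) ^ n / fact n))"
      unfolding norm by simp
    \<comment> \<open>The terms are nonnegative, so a bound on the partial sums that is uniform in
      \<open>N\<close> suffices; the integral of the majorant is one.\<close>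
    show "summable (\<lambda>n. \<integral>\<omega>. norm ((t * Y \<omega>) ^ n / fact n) \<partial>M)"
    proof (rule summableI_nonneg_bounded)
      fix N
      have "(\<Sum>n<N. \<integral>\<omega>. norm ((t * Y \<omega>) ^ n / fact n) \<partial>M)
          = (\<integral>\<omega>. (\<Sum>n<N. norm ((t * Y \<omega>) ^ n / fact n)) \<partial>M)"
        using int by (intro Bochner_Integration.integral_sum[symmetric] integrable_norm)
      also have "\<dots> \<le> (\<integral>\<omega>. exp \<bar>t * Y \<omega>\<bar> \<partial>M)"
      proof (intro integral_mono Bochner_Integration.integrable_sum integrable_norm int exp)
        show "(\<Sum>n<N. norm ((t * Y \<omega>) ^ n / fact n)) \<le> exp \<bar>t * Y \<omega>\<bar>" for \<omega>
          unfolding norm by (rule sum_power_div_fact_le_exp) auto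
      qed
      finally show "(\<Sum>n<N. \<integral>\<omega>. norm ((t * Y \<omega>) ^ n / fact n) \<partial>M) \<le> (\<integral>\<omega>. exp \<bar>t * Y \<omega>\<bar> \<partial>M)" .
    qed simp
  qed
  moreover have "(\<Sum>n. (t * Y \<omega>) ^ n / fact n) = exp (t * Y \<omega>)" for \<omega>
    by (simp add: exp_def field_simps)
  ultimately show ?thesis
    by (simp add: mgf_def power_mult_distrib mult.commute)
qed

definition moment_fps :: "'a measure \<Rightarrow> ('a \<Rightarrow> real) \<Rightarrow> real fps" where
  "moment_fps M Y = Abs_fps (\<lambda>n. integral\<^sup>L M (\<lambda>\<omega>. Y \<omega> ^ n) / fact n)"

lemma mgf_has_fps_expansion:
  fixes Y :: "'a \<Rightarrow> real"
  assumes meas: "Y \<in> borel_measurable M" and "\<delta> > 0"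
    and int: "\<And>t::real. \<bar>t\<bar> < \<delta> \<Longrightarrow> integrable M (\<lambda>\<omega>. exp (t * Y \<omega>))"
  shows "mgf M Y has_fps_expansion moment_fps M Y"
proof -
  have sums: "(\<lambda>n. moment_fps M Y $ n * t ^ n) sums mgf M Y t" if "\<bar>t\<bar> < \<delta>" for t
    using mgf_sums_moments[OF meas integrable_exp_abs[OF meas int int]] that
    by (simp add: moment_fps_def)
  \<comment> \<open>Only a positive radius is required, so summability at one nonzero point inside
    the interval is enough.\<close>
  have "fps_conv_radius (moment_fps M Y) \<ge> norm (\<delta> / 2)"
    unfolding fps_conv_radius_def using sums[of "\<delta> / 2"] \<open>\<delta> > 0\<close>
    by (intro conv_radius_geI) (auto simp: sums_iff)
  moreover have "eventually (\<lambda>t. t \<in> ball 0 \<delta>) (nhds (0::real))"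
    using \<open>\<delta> > 0\<close> by (intro eventually_nhds_in_open) auto
  then have "eventually (\<lambda>t. eval_fps (moment_fps M Y) t = mgf M Y t) (nhds 0)"
    by eventually_elim (use sums in \<open>auto simp: eval_fps_def sums_iff\<close>)
  moreover have "0 < ereal (norm (\<delta> / 2))"
    using \<open>\<delta> > 0\<close> by simp
  ultimately show ?thesis
    unfolding has_fps_expansion_def by (meson less_le_trans)
qed

section \<open>Formal generating series of the r-Stirling numbers\<close>

definition r_stirling_fps :: "real fps \<Rightarrow> nat \<Rightarrow> nat \<Rightarrow> real fps" where
  "r_stirling_fps G r k = fps_const (1 / fact k) * (G - 1) ^ k * fps_exp (real r)"

text \<open>\<open>G - 1\<close> has no constant term, so its \<open>k\<close>-th power starts at
  degree \<open>k\<close> or later, and multiplying by the exponential series cannot lower that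
  degree.\<close>

lemma r_stirling_fps_nth_eq_0:
  assumes "G $ 0 = 1" "i < k"
  shows "r_stirling_fps G r k $ i = 0"
proof -
  have "(G - 1) ^ k $ j = 0" if "j \<le> i" for j
    using startsby_zero_power_prefix[of "G - 1" k] assms that by simp
  then show ?thesis
    by (simp add: r_stirling_fps_def fps_mult_nth mult.assoc)
qed

lemma fps_deriv_r_stirling_fps_0:
  "fps_deriv (r_stirling_fps G r 0) = fps_const (real r) * r_stirling_fps G r 0"
  by (simp add: r_stirling_fps_def)

lemma fps_deriv_r_stirling_fps_Suc:
  "fps_deriv (r_stirling_fps G r (Suc k)) =
     fps_deriv G * r_stirling_fps G r k + fps_const (real r) * r_stirling_fps G r (Suc k)"
proof -
  \<comment> \<open>The factor \<open>Suc k\<close> from the power rule turns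
    \<open>1 / fact (Suc k)\<close> into the normalisation for index \<open>k\<close>.\<close>
  have "fps_const (1 / fact (Suc k)) * fps_const (of_nat (Suc k)) = fps_const (1 / fact k :: real)"
    by (simp del: of_nat_Suc add: divide_simps)
  then have "fps_deriv (fps_const (1 / fact (Suc k)) * (G - 1) ^ Suc k) =
      fps_const (1 / fact k) * (fps_deriv G * (G - 1) ^ k)"
    by (simp only: fps_deriv_mult_const_left fps_deriv_power diff_Suc_1 fps_deriv_sub
        fps_deriv_1 diff_zero mult.assoc[symmetric])
  then show ?thesis
    unfolding r_stirling_fps_def by (simp add: algebra_simps del: power_Suc fact_Suc)
qed

lemma prob_r_stirling_eq:
  assumes "mgf M Y has_fps_expansion G" "G $ 0 = 1"
  shows "prob_r_stirling M Y r n k = fact n * r_stirling_fps G r k $ n"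
proof -
  let ?f = "\<lambda>t. 1 / fact k * (mgf M Y t - 1) ^ k * exp (real r * t)"
  have "?f has_fps_expansion r_stirling_fps G r k"
    unfolding r_stirling_fps_def
    by (intro fps_expansion_intros has_fps_expansion_power assms)
  then have "(THE F. ?f has_fps_expansion F \<and> (\<forall>i<k. F $ i = 0)) = r_stirling_fps G r k"
    using r_stirling_fps_nth_eq_0[OF assms(2)]
    by (intro the_equality) (auto intro: has_fps_expansion_unique)
  then show ?thesis
    by (simp add: prob_r_stirling_def)
qed

text \<open>Exponential generating functions multiply by binomial convolution; this is where the
  binomial coefficients of the recurrence come from.\<close>

lemma fact_fps_nth_mult:
  fixes F G :: "'a :: field_char_0 fps"
  shows "fact n * (F * G) $ n =
    (\<Sum>j=0..n. of_nat (n choose j) * (fact j * F $ j) * (fact (n - j) * G $ (n - j)))"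
  unfolding fps_mult_nth sum_distrib_left
  by (intro sum.cong) (auto simp: binomial_fact)

section \<open>Recurrences for the numbers and the polynomials\<close>

context
  fixes M :: "'a measure" and Y :: "'a \<Rightarrow> real" and r :: nat
  assumes expansion: "mgf M Y has_fps_expansion moment_fps M Y"
    and moment_0: "moment_fps M Y $ 0 = 1"
begin

lemmas prob_r_stirling_fps = prob_r_stirling_eq[OF expansion moment_0]

lemma prob_r_stirling_eq_0: "n < k \<Longrightarrow> prob_r_stirling M Y r n k = 0"
  by (simp add: prob_r_stirling_fps r_stirling_fps_nth_eq_0 moment_0)

lemma prob_r_stirling_Suc_0:
  "prob_r_stirling M Y r (Suc n) 0 = real r * prob_r_stirling M Y r n 0"
  using arg_cong[OF fps_deriv_r_stirling_fps_0, of "\<lambda>F. fact n * F $ n" "moment_fps M Y" r]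
  by (simp add: prob_r_stirling_fps algebra_simps)

lemma prob_r_stirling_Suc_Suc:
  "prob_r_stirling M Y r (Suc n) (Suc k) =
     (\<Sum>j=0..n. real (n choose j) * integral\<^sup>L M (\<lambda>\<omega>. Y \<omega> ^ (j + 1))
        * prob_r_stirling M Y r (n - j) k)
     + real r * prob_r_stirling M Y r n (Suc k)"
proof -
  \<comment> \<open>Differentiating an exponential generating function shifts its sequence by one,
    hence the exponent \<open>j + 1\<close>.\<close>
  have moment: "fact j * fps_deriv (moment_fps M Y) $ j = integral\<^sup>L M (\<lambda>\<omega>. Y \<omega> ^ (j + 1))" for j
    by (simp add: moment_fps_def divide_simps del: of_nat_Suc)
  have "prob_r_stirling M Y r (Suc n) (Suc k)
      = fact n * fps_deriv (r_stirling_fps (moment_fps M Y) r (Suc k)) $ n"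
    by (simp add: prob_r_stirling_fps algebra_simps)
  also have "\<dots> = fact n * (fps_deriv (moment_fps M Y) * r_stirling_fps (moment_fps M Y) r k) $ n
      + real r * prob_r_stirling M Y r n (Suc k)"
    by (simp add: fps_deriv_r_stirling_fps_Suc prob_r_stirling_fps algebra_simps del: fps_deriv_nth)
  finally show ?thesis
    unfolding fact_fps_nth_mult moment prob_r_stirling_fps .
qed

text \<open>The added terms vanish. A common upper limit for all the polynomials of index
  \<open>n - j\<close> is what lets the double sum be interchanged.\<close>

lemma prob_r_bell_poly_extend:
  assumes "n \<le> N"
  shows "prob_r_bell_poly M Y r n x = (\<Sum>k=0..N. prob_r_stirling M Y r n k * x ^ k)"
  unfolding prob_r_bell_poly_def
  by (rule sum.mono_neutral_left) (use assms in \<open>auto simp: prob_r_stirling_eq_0\<close>)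

lemma prob_r_bell_poly_Suc:
  "prob_r_bell_poly M Y r (Suc n) x =
     x * (\<Sum>j=0..n. real (n choose j) * integral\<^sup>L M (\<lambda>\<omega>. Y \<omega> ^ (j + 1))
            * prob_r_bell_poly M Y r (n - j) x)
     + real r * prob_r_bell_poly M Y r n x"
proof -
  let ?S = "prob_r_stirling M Y r"
  let ?c = "\<lambda>j. real (n choose j) * integral\<^sup>L M (\<lambda>\<omega>. Y \<omega> ^ (j + 1))"
  \<comment> \<open>The term \<open>k = 0\<close> is split off because its recurrence has no
    convolution part.\<close>
  have "prob_r_bell_poly M Y r (Suc n) x
      = real r * ?S n 0 + (\<Sum>k=0..n. ?S (Suc n) (Suc k) * x ^ Suc k)"
    unfolding prob_r_bell_poly_def
    by (subst sum.atLeast0_atMost_Suc_shift) (simp add: prob_r_stirling_Suc_0)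
  also have "(\<Sum>k=0..n. ?S (Suc n) (Suc k) * x ^ Suc k)
      = (\<Sum>k=0..n. \<Sum>j=0..n. x * (?c j * (?S (n - j) k * x ^ k)))
        + real r * (\<Sum>k=0..n. ?S n (Suc k) * x ^ Suc k)"
    unfolding prob_r_stirling_Suc_Suc
    by (simp add: sum.distrib sum_distrib_left sum_distrib_right algebra_simps)
  also have "(\<Sum>k=0..n. \<Sum>j=0..n. x * (?c j * (?S (n - j) k * x ^ k)))
      = x * (\<Sum>j=0..n. ?c j * (\<Sum>k=0..n. ?S (n - j) k * x ^ k))"
    by (subst sum.swap) (simp add: sum_distrib_left)
  also have "\<dots> = x * (\<Sum>j=0..n. ?c j * prob_r_bell_poly M Y r (n - j) x)"
    by (simp add: prob_r_bell_poly_extend[of _ n])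
  \<comment> \<open>The split-off term returns as the \<open>k = 0\<close> summand. The sum now runs
    to \<open>Suc n\<close>, but \<open>?S n (Suc n)\<close> is zero, so it is still the polynomial
    of index \<open>n\<close>.\<close>
  also have "real r * ?S n 0 + (\<dots> + real r * (\<Sum>k=0..n. ?S n (Suc k) * x ^ Suc k))
      = \<dots> + real r * (\<Sum>k=0..Suc n. ?S n k * x ^ k)"
    by (subst sum.atLeast0_atMost_Suc_shift) (simp add: algebra_simps)
  finally show ?thesis
    by (simp only: prob_r_bell_poly_extend[of n "Suc n"] le_SucI order_refl)
qed

end

theorem theorem2p4:
  fixes M :: "'a measure" and Y :: "'a \<Rightarrow> real" and \<delta> :: real and r :: nat
  assumes "prob_space M"
    and "Y \<in> borel_measurable M"
    and "\<delta> > 0"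
    and "\<And>t::real. \<bar>t\<bar> < \<delta> \<Longrightarrow> integrable M (\<lambda>\<omega>. exp (t * Y \<omega>))"
    and "r > 0"
  shows "\<forall>(n::nat) (x::real).
    prob_r_bell_poly M Y r (n + 1) x =
      x * (\<Sum>k=0..n. real (n choose k) * prob_space.expectation M (\<lambda>\<omega>. Y \<omega> ^ (k + 1))
             * prob_r_bell_poly M Y r (n - k) x)
      + real r * prob_r_bell_poly M Y r n x"
proof -
  have "mgf M Y has_fps_expansion moment_fps M Y"
    using assms(2-4) by (rule mgf_has_fps_expansion)
  \<comment> \<open>The zeroth moment is the total mass of the probability space.\<close>
  moreover have "moment_fps M Y $ 0 = 1"
    using prob_space.prob_space[OF assms(1)] by (simp add: moment_fps_def)
  ultimately show ?thesis
    using prob_r_bell_poly_Suc[of M Y r] by simp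
qed

end
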